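(* Let $q$ be a prime and let the positive integers $n$, $k\le n$, $d\le n$ fulfill $$\sum_{i=0}^{d-2}\binom{n-1}{i}(q-1)^i<q^{\,n-k}.$$ Then there exists an $[n',k',d]_q$ code that contains the all-one vector, where $n'$ and $k'$ satisfy $$n-d+2\le n'\le n+1,\qquad k-d+2\le k'\le k+1.$$ Moreover, the parity-check matrix $H$ of this $[n',k',d]_q$ code can be constructed as follows. 1. Start from the $(n-k)\times(n-k)$ identity matrix, with columns $h_1,\dots,h_{n-k}$, and for $l=n-k+1,\dots,n$ successively add a column $h_l\in\mathbb{F}_q^{n-k}$ that is linearly independent of any collection of $d-2$ previous columns (such a column exists because $\sum_{i=0}^{d-2}\binom{l-1}{i}(q-1)^i<q^{n-k}$). 2. Set $p:=-\sum_{i=1}^{n}h_i$. 3. If $p$ is linearly independent of any $d-2$ of the columns $h_1,\dots,h_n$, let $H:=(h_1,\dots,h_n,p)$. 4. Otherwise write $p=\sum_{j=1}^{\delta}a_jh_{i_j}$ with $\delta\le d-2$, distinct indices $i_1,\dots,i_\delta$ and $a_j\in\{1,\dots,q-1\}$, and let $H$ be the matrix whose columns are the $h_i$ with $i\notin\{i_1,\dots,i_\delta\}$ together with the columns $(a_j+1)h_{i_j}$ for those $j$ with $a_j\neq q-1$ (the columns $h_{i_j}$ with $a_j=q-1$ are removed).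
   Context: $\mathbb{F}_q$ is the finite field of order $q$. An $[n',k',d]_q$ code is a linear code over $\mathbb{F}_q$ of length $n'$, dimension $k'$ and minimum Hamming distance $d$. The all-one vector is $(1,\dots,1)\in\mathbb{F}_q^{n'}$. A parity-check matrix of a linear code is a matrix over $\mathbb{F}_q$ whose right kernel is the code.
   Formalization: The code with parity-check matrix H from steps 1–4 is shown to have minimum distance at least d, not exactly d: for q=2, n=5, k=2, d=3 the steps always give the [4,1,4] code. A code of minimum distance exactly d is shown to exist separately. *)

theory Defs
  imports
    "HOL-Computational_Algebra.Primes"
    "Jordan_Normal_Form.Matrix_Kernel"
begin

definition all_one :: "nat \<Rightarrow> 'a :: one vec" where
  "all_one n = vec n (\<lambda>_. 1)"

definition hamming_dist :: "'a vec \<Rightarrow> 'a vec \<Rightarrow> nat" where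
  "hamming_dist u v = card {i. i < dim_vec u \<and> u $ i \<noteq> v $ i}"

(* Inf {} = 0 on nat, so a code with fewer than two words has min_distance 0. *)
definition min_distance :: "'a vec set \<Rightarrow> nat" where
  "min_distance C = Inf {hamming_dist u v | u v. u \<in> C \<and> v \<in> C \<and> u \<noteq> v}"

definition linear_code :: "nat \<Rightarrow> nat \<Rightarrow> 'a :: field vec set \<Rightarrow> bool" where
  "linear_code n k C \<longleftrightarrow>
     subspace class_ring C (module_vec TYPE('a) n) \<and>
     vectorspace.dim class_ring ((module_vec TYPE('a) n)\<lparr>carrier := C\<rparr>) = k"

definition parity_check_matrix :: "'a :: field mat \<Rightarrow> 'a vec set \<Rightarrow> bool" where
  "parity_check_matrix H C \<longleftrightarrow> mat_kernel H = C"

(* v is linearly independent of any d - 2 of the columns h i, i \<in> I.  Collections are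
   collections of indices; the condition is vacuous for d = 1 and says v \<noteq> 0 for d = 2. *)
definition indep_of_any ::
    "nat \<Rightarrow> nat \<Rightarrow> (nat \<Rightarrow> 'a :: field vec) \<Rightarrow> nat set \<Rightarrow> 'a vec \<Rightarrow> bool" where
  "indep_of_any r d h I v \<longleftrightarrow>
     (\<forall>J\<subseteq>I. card J + 2 = d \<longrightarrow>
        v \<notin> LinearCombinations.module.span class_ring (module_vec TYPE('a) r) (h ` J))"

(* The columns of length r are h 1, ..., h m; the first r of them form the identity matrix. *)
definition greedy_columns :: "nat \<Rightarrow> nat \<Rightarrow> nat \<Rightarrow> (nat \<Rightarrow> 'a :: field vec) \<Rightarrow> bool" where
  "greedy_columns r d m h \<longleftrightarrow>
     (\<forall>l\<in>{1..r}. h l = col (1\<^sub>m r) (l - 1)) \<and>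
     (\<forall>l\<in>{r+1..m}. h l \<in> carrier_vec r \<and> indep_of_any r d h {1..<l} (h l))"

definition neg_col_sum :: "nat \<Rightarrow> nat \<Rightarrow> (nat \<Rightarrow> 'a :: field vec) \<Rightarrow> 'a vec" where
  "neg_col_sum r n h = - finsum_vec TYPE('a) r h {1..n}"

(* H is a possible result of completing h 1, ..., h n to a parity-check matrix.  The elements
   of the prime field are written as naturals 0, ..., q - 1, and i 1, ..., i \<delta> are the indices
   in the representation of p.  The kernel of H may have minimum distance greater than d: for
   q = 2, n = 5, r = 3, d = 3 it is the repetition code of length 4, whatever columns are chosen. *)
definition completed_matrix ::
    "nat \<Rightarrow> nat \<Rightarrow> nat \<Rightarrow> nat \<Rightarrow> (nat \<Rightarrow> 'a :: field vec) \<Rightarrow> 'a mat \<Rightarrow> bool" where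
  "completed_matrix q r d n h H \<longleftrightarrow>
     (let p = neg_col_sum r n h in
      if indep_of_any r d h {1..n} p
      then H = mat_of_cols r (map h [1..<n+1] @ [p])
      else (\<exists>(\<delta>::nat) (i :: nat \<Rightarrow> nat) (a :: nat \<Rightarrow> nat).
              \<delta> + 2 \<le> d \<and> inj_on i {1..\<delta>} \<and> i ` {1..\<delta>} \<subseteq> {1..n} \<and>
              (\<forall>j\<in>{1..\<delta>}. a j \<in> {1..q-1}) \<and>
              p = finsum_vec TYPE('a) r (\<lambda>j. of_nat (a j) \<cdot>\<^sub>v h (i j)) {1..\<delta>} \<and>
              H = mat_of_cols r
                    (map h [l \<leftarrow> [1..<n+1]. l \<notin> i ` {1..\<delta>}] @
                     map (\<lambda>j. of_nat (a j + 1) \<cdot>\<^sub>v h (i j)) [j \<leftarrow> [1..<\<delta>+1]. a j \<noteq> q - 1])))"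

end

(* Every dimension is read off from a cardinality, since a subspace of dimension k has q^k elements.

   A relation between the greedily chosen columns involves at least d of them: the last column that
   occurs in a shorter relation would be a combination of at most d - 2 earlier ones (the first
   n - k columns are independent anyway).  Step 3 of the construction is one more greedy step, and
   the kernel of the matrix of step 4 embeds into the kernel of (h_1, ..., h_n) with preservation
   of weights, by rescaling coordinates and inserting zeros.  The columns of either matrix sum to 0,
   so the kernel contains the all-one vector.

   This only bounds the minimum distance from below.  A code of minimum distance exactly d arises
   from the constructed one by interpolation if k >= d, when its dimension is at least 2; if k < d,
   a repetition code or the code of all words a^d b^(n+1-d) has the right parameters. *)

theory Submission
  imports Defs "HOL-Number_Theory.Residues" "Berlekamp_Zassenhaus.Berlekamp_Type_Based"
begin

section \<open>Subspaces over a finite field: dimension as the exponent of the cardinality\<close>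

lemma subspace_module_vec_iff:
  fixes C :: "'a :: field vec set"
  shows "subspace class_ring C (module_vec TYPE('a) n) \<longleftrightarrow>
    C \<subseteq> carrier_vec n \<and> 0\<^sub>v n \<in> C \<and> (\<forall>u\<in>C. \<forall>v\<in>C. u + v \<in> C) \<and> (\<forall>a. \<forall>v\<in>C. a \<cdot>\<^sub>v v \<in> C)"
  unfolding VectorSpace.subspace_def submodule_def module_vec_simps class_ring_simps
  using vec_vs[of n, where 'a = 'a] vec_module[of n, where 'a = 'a] by blast

text \<open>Coordinates with respect to a basis: unique representation makes \<open>lincomb\<close>
  a bijection from the extensional coefficient functions on the basis onto the space.\<close>

lemma (in vectorspace) card_carrier_eq_power_dim:
  assumes "finite (carrier V)"
  shows "card (carrier V) = card (carrier K) ^ dim"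
proof -
  have "span (carrier V) = carrier V"
    using span_is_subset2[of "carrier V"] in_own_span[of "carrier V"] by auto
  then have "fin_dim"
    using assms unfolding fin_dim_def by blast
  then obtain B where B: "finite B" "basis B"
    using finite_basis_exists by blast
  then have sub: "B \<subseteq> carrier V" by (simp add: basis_def)
  have uniq: "\<exists>!a. a \<in> B \<rightarrow>\<^sub>E carrier K \<and> lincomb a B = v" if "v \<in> carrier V" for v
    using basis_criterion[OF B(1) sub] B(2) that by blast
  have closed: "lincomb a B \<in> carrier V" if "a \<in> B \<rightarrow>\<^sub>E carrier K" for a
    using that sub by (intro lincomb_closed) auto
  have "bij_betw (\<lambda>a. lincomb a B) (B \<rightarrow>\<^sub>E carrier K) (carrier V)"
    unfolding bij_betw_def
  proof
    show "inj_on (\<lambda>a. lincomb a B) (B \<rightarrow>\<^sub>E carrier K)"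
      using uniq closed by (intro inj_onI) metis
    show "(\<lambda>a. lincomb a B) ` (B \<rightarrow>\<^sub>E carrier K) = carrier V"
    proof
      show "carrier V \<subseteq> (\<lambda>a. lincomb a B) ` (B \<rightarrow>\<^sub>E carrier K)"
        using uniq by (metis (no_types, lifting) image_iff subsetI)
    qed (use closed in auto)
  qed
  then have "card (carrier V) = card (B \<rightarrow>\<^sub>E carrier K)"
    by (simp add: bij_betw_same_card)
  then show ?thesis
    using B by (simp add: card_PiE dim_basis)
qed

lemma card_subspace_eq_power_dim:
  fixes C :: "'a :: {field, finite} vec set"
  assumes "subspace class_ring C (module_vec TYPE('a) n)"
  shows "card C = CARD('a) ^ vectorspace.dim class_ring ((module_vec TYPE('a) n)\<lparr>carrier := C\<rparr>)"
proof -
  interpret vectorspace class_ring "(module_vec TYPE('a) n)\<lparr>carrier := C\<rparr>"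
    using vectorspace.subspace_is_vs[OF vec_vs assms] .
  have "finite C"
    using assms finite_subset[OF _ finite_carrier_vec] by (auto simp: subspace_module_vec_iff)
  then show ?thesis
    using card_carrier_eq_power_dim by (simp add: class_ring_simps)
qed

lemma one_less_card_field: "1 < CARD('a :: {field, finite})"
  using card_mono[of UNIV "{0, 1 :: 'a}"] by simp

text \<open>The order of the field exceeds 1, so its powers are distinct and the size of a subspace
  determines the dimension.\<close>

lemma linear_code_iff_card:
  fixes C :: "'a :: {field, finite} vec set"
  shows "linear_code n k C \<longleftrightarrow>
    subspace class_ring C (module_vec TYPE('a) n) \<and> card C = CARD('a) ^ k"
  using card_subspace_eq_power_dim one_less_card_field[where 'a = 'a]
  by (auto simp: linear_code_def)

section \<open>Weights and minimum distance\<close>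

definition weight :: "'a :: zero vec \<Rightarrow> nat" where
  "weight v = card {i. i < dim_vec v \<and> v $ i \<noteq> 0}"

lemma weight_eq_0_iff: "weight v = 0 \<longleftrightarrow> v = 0\<^sub>v (dim_vec v)"
  by (auto simp: weight_def vec_eq_iff)

lemma hamming_dist_eq_weight:
  fixes u v :: "'a :: field vec"
  assumes "dim_vec u = dim_vec v"
  shows "hamming_dist u v = weight (u - v)"
  using assms unfolding hamming_dist_def weight_def by (intro arg_cong[where f = card]) auto

lemma hamming_dist_set_subspace:
  fixes C :: "'a :: field vec set"
  assumes "subspace class_ring C (module_vec TYPE('a) n)"
  shows "{hamming_dist u v | u v. u \<in> C \<and> v \<in> C \<and> u \<noteq> v} = weight ` (C - {0\<^sub>v n})"
proof (intro equalityI subsetI)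
  note C = assms[unfolded subspace_module_vec_iff]
  fix x assume "x \<in> {hamming_dist u v | u v. u \<in> C \<and> v \<in> C \<and> u \<noteq> v}"
  then obtain u v where uv: "u \<in> C" "v \<in> C" "u \<noteq> v" "x = hamming_dist u v" by blast
  then have car: "u \<in> carrier_vec n" "v \<in> carrier_vec n" using C by auto
  have "u + (-1) \<cdot>\<^sub>v v \<in> C" using C uv by blast
  also have "u + (-1) \<cdot>\<^sub>v v = u - v" using car by auto
  finally have "u - v \<in> C" .
  moreover have "u - v \<noteq> 0\<^sub>v n"
    using uv(3) car by (auto simp: vec_eq_iff)
  moreover have "x = weight (u - v)"
    using uv(4) car by (simp add: hamming_dist_eq_weight)
  ultimately show "x \<in> weight ` (C - {0\<^sub>v n})" by blast
next
  note C = assms[unfolded subspace_module_vec_iff]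
  fix x assume "x \<in> weight ` (C - {0\<^sub>v n})"
  then obtain u where u: "u \<in> C" "u \<noteq> 0\<^sub>v n" "x = weight u" by blast
  then have "u \<in> carrier_vec n" using C by auto
  then have "x = hamming_dist u (0\<^sub>v n)" using u(3) by (simp add: hamming_dist_eq_weight)
  then show "x \<in> {hamming_dist u v | u v. u \<in> C \<and> v \<in> C \<and> u \<noteq> v}"
    using u C by blast
qed

text \<open>Differences of words are words, so the distances are weights. The second assumption
  keeps the infimum away from the empty set, whose value 0 would break the equivalence for positive
  \<open>d\<close>.\<close>

lemma le_min_distance_iff:
  fixes C :: "'a :: field vec set"
  assumes "subspace class_ring C (module_vec TYPE('a) n)" and "\<not> C \<subseteq> {0\<^sub>v n}"
  shows "d \<le> min_distance C \<longleftrightarrow> (\<forall>c\<in>C. c \<noteq> 0\<^sub>v n \<longrightarrow> d \<le> weight c)"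
proof -
  have "C - {0\<^sub>v n} \<noteq> {}" using assms(2) by blast
  then show ?thesis
    unfolding min_distance_def hamming_dist_set_subspace[OF assms(1)]
    by (subst le_cInf_iff) auto
qed

lemma min_distance_eqI:
  fixes C :: "'a :: field vec set"
  assumes "subspace class_ring C (module_vec TYPE('a) n)"
    and "\<And>c. c \<in> C \<Longrightarrow> c \<noteq> 0\<^sub>v n \<Longrightarrow> d \<le> weight c"
    and "c \<in> C" "c \<noteq> 0\<^sub>v n" "weight c = d"
  shows "min_distance C = d"
proof (rule antisym)
  show "d \<le> min_distance C"
    using assms le_min_distance_iff[OF assms(1), of d] by blast
  \<comment> \<open>With \<open>min_distance C\<close> itself as the bound, the criterion says that
    no nonzero word is lighter, in particular not \<open>c\<close>.\<close>
  show "min_distance C \<le> d"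
    using assms le_min_distance_iff[OF assms(1), of "min_distance C"] by blast
qed

section \<open>Kernels and spans in coordinates\<close>

lemma mem_mat_kernel_mat_of_cols_iff:
  fixes vs :: "'a :: comm_ring_1 vec list"
  assumes "set vs \<subseteq> carrier_vec r"
  shows "x \<in> mat_kernel (mat_of_cols r vs) \<longleftrightarrow>
    x \<in> carrier_vec (length vs) \<and> (\<forall>i<r. (\<Sum>j<length vs. x $ j * vs ! j $ i) = 0)"
proof -
  have "mat_of_cols r vs *\<^sub>v x = 0\<^sub>v r \<longleftrightarrow> (\<forall>i<r. (\<Sum>j<length vs. x $ j * vs ! j $ i) = 0)"
    if "x \<in> carrier_vec (length vs)"
    using that by (auto simp: vec_eq_iff scalar_prod_def mat_of_cols_def mult.commute
        atLeast0LessThan)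
  then show ?thesis
    by (auto simp: mat_kernel[of _ r "length vs"])
qed

lemma mult_mat_vec_zero:
  fixes A :: "'a :: semiring_0 mat"
  assumes "A \<in> carrier_mat nr nc"
  shows "A *\<^sub>v 0\<^sub>v nc = 0\<^sub>v nr"
  using assms by (intro eq_vecI) auto

lemma subspace_mat_kernel:
  fixes A :: "'a :: field mat"
  assumes A: "A \<in> carrier_mat nr nc"
  shows "subspace class_ring (mat_kernel A) (module_vec TYPE('a) nc)"
  using mult_add_distrib_mat_vec[OF A] mult_mat_vec[OF A] mult_mat_vec_zero[OF A]
  by (auto simp: subspace_module_vec_iff mat_kernel[OF A])

text \<open>Spans are taken of sets of vectors, while relations between columns are indexed and
  columns may coincide. This coordinate form, with one coefficient per index, mediates between the
  two.\<close>

lemma mem_span_image_iff: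
  fixes h :: "'b \<Rightarrow> 'a :: field vec"
  assumes J: "finite J" and h: "h ` J \<subseteq> carrier_vec r"
  shows "v \<in> LinearCombinations.module.span class_ring (module_vec TYPE('a) r) (h ` J) \<longleftrightarrow>
    v \<in> carrier_vec r \<and> (\<exists>c. \<forall>i<r. v $ i = (\<Sum>l\<in>J. c l * h l $ i))"
proof -
  interpret vec_space "TYPE('a)" r .
  show ?thesis
  proof (intro iffI conjI)
    assume v: "v \<in> span (h ` J)"
    then show "v \<in> carrier_vec r" using h span_closed by blast
    obtain a where a: "lincomb a (h ` J) = v"
      using finite_in_span[OF _ h v] J by blast
    \<comment> \<open>\<open>J'\<close> keeps one index per vector; the other indices in
      \<open>J\<close> receive coefficient 0.\<close>
    obtain J' where J': "J' \<subseteq> J" "inj_on h J'" "h ` J = h ` J'"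
      using subset_image_inj[of "h ` J" h J] by auto
    have "v $ i = (\<Sum>l\<in>J. (if l \<in> J' then a (h l) else 0) * h l $ i)" if "i < r" for i
    proof -
      have "v $ i = (\<Sum>w\<in>h ` J'. a w * w $ i)"
        using lincomb_index[OF that h, of a] a J'(3) by simp
      also have "\<dots> = (\<Sum>l\<in>J'. a (h l) * h l $ i)"
        using J'(2) by (simp add: sum.reindex)
      also have "\<dots> = (\<Sum>l\<in>J. (if l \<in> J' then a (h l) else 0) * h l $ i)"
        using J J'(1) by (intro sum.mono_neutral_cong_left) auto
      finally show ?thesis .
    qed
    then show "\<exists>c. \<forall>i<r. v $ i = (\<Sum>l\<in>J. c l * h l $ i)"
      by (intro exI[of _ "\<lambda>l. if l \<in> J' then a (h l) else 0"] allI impI)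
  next
    assume "v \<in> carrier_vec r \<and> (\<exists>c. \<forall>i<r. v $ i = (\<Sum>l\<in>J. c l * h l $ i))"
    then obtain c where v: "v \<in> carrier_vec r"
      and c: "\<forall>i<r. v $ i = (\<Sum>l\<in>J. c l * h l $ i)"
      by (elim conjE exE)
    \<comment> \<open>Indices that carry the same vector are merged by adding their
      coefficients.\<close>
    define a where "a w = (\<Sum>l | l \<in> J \<and> h l = w. c l)" for w
    have "v = lincomb a (h ` J)"
    proof (rule eq_vecI)
      have "dim_vec (lincomb a (h ` J)) = r"
        using J h by (intro lincomb_dim) auto
      then show "dim_vec v = dim_vec (lincomb a (h ` J))" using v by simp
      fix i assume "i < dim_vec (lincomb a (h ` J))"
      with \<open>dim_vec (lincomb a (h ` J)) = r\<close> have i: "i < r" by simp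
      have "v $ i = (\<Sum>w\<in>h ` J. \<Sum>l | l \<in> J \<and> h l = w. c l * h l $ i)"
        using c[rule_format, OF i] sum.image_gen[OF J, of "\<lambda>l. c l * h l $ i" h] by simp
      also have "\<dots> = (\<Sum>w\<in>h ` J. a w * w $ i)"
        by (intro sum.cong refl) (simp add: a_def sum_distrib_right)
      finally show "v $ i = lincomb a (h ` J) $ i"
        using lincomb_index[OF i h] by simp
    qed
    then show "v \<in> span (h ` J)"
      using J unfolding span_def by blast
  qed
qed

section \<open>Columns chosen greedily and the relations between them\<close>

lemma greedy_columns_carrier:
  assumes "greedy_columns r d m h" and "l \<in> {1..m}"
  shows "h l \<in> carrier_vec r"
proof (cases "l \<le> r")
  case True
  then have "h l = col (1\<^sub>m r) (l - 1)"
    using assms by (simp add: greedy_columns_def)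
  then show ?thesis
    by (metis carrier_vecI dim_col index_one_mat(2))
next
  case False
  then show ?thesis
    using assms by (simp add: greedy_columns_def)
qed

lemma greedy_columns_identity:
  assumes "greedy_columns r d m h" and "l \<in> {1..r}" and "i < r"
  shows "h l $ i = (if i = l - 1 then 1 else 0)"
  using assms by (auto simp: greedy_columns_def)

lemma indep_of_any_cong:
  assumes "\<And>l. l \<in> I \<Longrightarrow> h l = h' l"
  shows "indep_of_any r d h I v = indep_of_any r d h' I v"
proof -
  have "h ` J = h' ` J" if "J \<subseteq> I" for J
    using that assms by (intro image_cong) auto
  then show ?thesis by (simp add: indep_of_any_def)
qed

text \<open>An independence condition looks only at earlier columns, so overwriting position
  \<open>Suc m\<close> disturbs none of the old ones. This serves the greedy induction as well as
  the appending of the negated column sum.\<close>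

lemma greedy_columns_Suc:
  fixes h :: "nat \<Rightarrow> 'a :: field vec"
  assumes h: "greedy_columns r d m h" and "r \<le> m"
    and v: "v \<in> carrier_vec r" "indep_of_any r d h {1..m} v"
  shows "greedy_columns r d (Suc m) (h(Suc m := v))"
  unfolding greedy_columns_def
proof (intro conjI ballI)
  let ?h = "h(Suc m := v)"
  show "?h l = col (1\<^sub>m r) (l - 1)" if "l \<in> {1..r}" for l
    using that h \<open>r \<le> m\<close> by (simp add: greedy_columns_def)
  fix l assume l: "l \<in> {r + 1..Suc m}"
  have "indep_of_any r d ?h {1..<l} w = indep_of_any r d h {1..<l} w" for w
    using l by (intro indep_of_any_cong) auto
  moreover have "{1..<Suc m} = {1..m}" by auto
  ultimately show "?h l \<in> carrier_vec r" "indep_of_any r d ?h {1..<l} (?h l)"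
    using l h v by (cases "l = Suc m"; simp add: greedy_columns_def)+
qed

text \<open>The distance bound, phrased for coefficient families on all of \<open>{1..m}\<close>
  rather than for words, so that it also serves matrices whose columns are rescaled or deleted. The
  argument examines the largest index \<open>M\<close> of the support.\<close>

lemma greedy_columns_relation_support:
  fixes h :: "nat \<Rightarrow> 'a :: field vec"
  assumes h: "greedy_columns r d m h" and "r \<le> m" and "d \<le> r + 1"
    and rel: "\<And>i. i < r \<Longrightarrow> (\<Sum>l\<in>{1..m}. c l * h l $ i) = 0"
    and nz: "l0 \<in> {1..m}" "c l0 \<noteq> 0"
  shows "d \<le> card {l \<in> {1..m}. c l \<noteq> 0}"
proof (rule ccontr)
  define S where "S = {l \<in> {1..m}. c l \<noteq> 0}"
  assume "\<not> ?thesis"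
  then have small: "card S < d" by (simp add: S_def)
  have fin: "finite S" and ne: "S \<noteq> {}" using nz by (auto simp: S_def)
  define M where "M = Max S"
  have M: "M \<in> S" "\<And>l. l \<in> S \<Longrightarrow> l \<le> M"
    using fin ne by (auto simp: M_def)
  have relS: "(\<Sum>l\<in>S. c l * h l $ i) = 0" if "i < r" for i
    using rel[OF that] by (subst sum.mono_neutral_left[of "{1..m}"]) (auto simp: S_def)
  show False
  proof (cases "M \<le> r")
    case True
    have M1: "1 \<le> M" using M by (simp add: S_def)
    \<comment> \<open>Only identity columns occur here. Column \<open>l\<close> has its 1 in row
      \<open>l - 1\<close>, so row \<open>M - 1\<close> isolates \<open>c M\<close>.\<close>
    have "(\<Sum>l\<in>S. c l * h l $ (M - 1)) = (\<Sum>l\<in>S. if l = M then c M else 0)"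
    proof (intro sum.cong refl)
      fix l assume l: "l \<in> S"
      then have "l \<in> {1..r}" using M(2)[OF l] True by (simp add: S_def)
      then show "c l * h l $ (M - 1) = (if l = M then c M else 0)"
        using greedy_columns_identity[OF h, of l "M - 1"] M1 True by auto
    qed
    also have "\<dots> = c M" using fin M by simp
    finally show False using relS[of "M - 1"] M M1 True by (simp add: S_def)
  next
    case False
    have cM: "c M \<noteq> 0" and Mm: "M \<le> m" using M by (simp_all add: S_def)
    have "S - {M} \<subseteq> {1..<M}"
    proof
      fix l assume "l \<in> S - {M}"
      then show "l \<in> {1..<M}" using M(2)[of l] by (auto simp: S_def)
    qed
    moreover have "card (S - {M}) = card S - 1" using fin M by simp
    moreover have "0 < card S" using fin ne by (simp add: card_gt_0_iff)
    ultimately have "S - {M} \<subseteq> {1..<M}" "card (S - {M}) \<le> d - 2" "d - 2 \<le> card {1..<M}"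
      using small \<open>d \<le> r + 1\<close> False by simp_all
    \<comment> \<open>\<open>indep_of_any\<close> speaks of collections of exactly
      \<open>d - 2\<close> indices, so the rest of the support is padded. There is room below
      \<open>M\<close>, since \<open>r < M\<close> and \<open>d \<le> r + 1\<close>.\<close>
    then obtain J where J: "S - {M} \<subseteq> J" "J \<subseteq> {1..<M}" "card J = d - 2"
      using exists_subset_between[of "S - {M}" "d - 2" "{1..<M}"] by auto
    have finJ: "finite J" using J(2) finite_subset by blast
    have hM: "h M \<in> carrier_vec r" "indep_of_any r d h {1..<M} (h M)"
      using h False Mm by (auto simp: greedy_columns_def)
    have hJ: "h ` J \<subseteq> carrier_vec r"
      using greedy_columns_carrier[OF h] J(2) Mm by force
    \<comment> \<open>Subtraction is truncated: only with this does \<open>card J = d - 2\<close>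
      give \<open>card J + 2 = d\<close>.\<close>
    have "2 \<le> d" using small \<open>0 < card S\<close> by simp
    then have notin: "h M \<notin> LinearCombinations.module.span class_ring (module_vec TYPE('a) r) (h ` J)"
      using hM(2) J by (simp add: indep_of_any_def)
    have "h M $ i = (\<Sum>l\<in>J. (- c l / c M) * h l $ i)" if i: "i < r" for i
    proof -
      \<comment> \<open>Padding indices outside \<open>S\<close> have coefficient 0, so the relation
        also holds over \<open>insert M J\<close> and can be solved for \<open>h M\<close>.\<close>
      have "(\<Sum>l\<in>insert M J. c l * h l $ i) = 0"
        using relS[OF i] J Mm finJ cM False
        by (subst sum.mono_neutral_right[of _ S]) (auto simp: S_def)
      then have "c M * h M $ i = - (\<Sum>l\<in>J. c l * h l $ i)"
        using J(2) finJ by (subst (asm) sum.insert) (auto simp: eq_neg_iff_add_eq_0)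
      then have "h M $ i = - (\<Sum>l\<in>J. c l * h l $ i) / c M"
        using cM by (metis nonzero_mult_div_cancel_left)
      also have "\<dots> = (\<Sum>l\<in>J. (- c l / c M) * h l $ i)"
        by (simp add: sum_divide_distrib flip: sum_negf)
      finally show ?thesis .
    qed
    then have "h M \<in> LinearCombinations.module.span class_ring (module_vec TYPE('a) r) (h ` J)"
      unfolding mem_span_image_iff[OF finJ hJ]
      by (intro conjI exI[of _ "\<lambda>l. - c l / c M"] allI impI hM(1))
    with notin show False by contradiction
  qed
qed

section \<open>Counting combinations and the existence of greedy columns\<close>

definition small_combinations :: "nat \<Rightarrow> nat \<Rightarrow> (nat \<Rightarrow> 'a :: field vec) \<Rightarrow> nat set \<Rightarrow> 'a vec set" where
  "small_combinations r d h I =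
     (\<Union>S\<in>{S. S \<subseteq> I \<and> card S + 2 \<le> d}.
        (\<lambda>c. vec r (\<lambda>i. \<Sum>l\<in>S. c l * h l $ i)) ` (S \<rightarrow>\<^sub>E (UNIV - {0})))"

text \<open>Union bound over the supports \<open>S\<close>, grouped by size. Coefficients are
  nonzero on all of \<open>S\<close>, so a support of size \<open>i\<close> accounts for
  \<open>(CARD('a) - 1) ^ i\<close> coefficient functions.\<close>

lemma card_small_combinations_le:
  fixes h :: "nat \<Rightarrow> 'a :: {field, finite} vec"
  assumes "finite I"
  shows "card (small_combinations r d h I) \<le>
    (\<Sum>i | i + 2 \<le> d. (card I choose i) * (CARD('a) - 1) ^ i)"
proof -
  let ?P = "{S. S \<subseteq> I \<and> card S + 2 \<le> d}"
  let ?F = "\<lambda>S. (\<lambda>c. vec r (\<lambda>i. \<Sum>l\<in>S. c l * h l $ i)) ` (S \<rightarrow>\<^sub>E (UNIV - {0}))"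
  have fin: "finite ?P" using assms by simp
  have finD: "finite {i. i + 2 \<le> d}" by (rule finite_subset[of _ "{..d}"]) auto
  have F: "card (?F S) \<le> (CARD('a) - 1) ^ card S" if "S \<subseteq> I" for S
  proof -
    have finS: "finite S" using that assms finite_subset by blast
    have "card (?F S) \<le> card (S \<rightarrow>\<^sub>E (UNIV - {0 :: 'a}))"
      using finS by (intro card_image_le finite_PiE) auto
    also have "\<dots> = (CARD('a) - 1) ^ card S"
      using finS by (simp add: card_PiE)
    finally show ?thesis .
  qed
  have "card (small_combinations r d h I) \<le> (\<Sum>S\<in>?P. card (?F S))"
    unfolding small_combinations_def by (rule card_UN_le[OF fin])
  also have "\<dots> \<le> (\<Sum>S\<in>?P. (CARD('a) - 1) ^ card S)"
    using F by (intro sum_mono) auto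
  also have "\<dots> = (\<Sum>i\<in>{i. i + 2 \<le> d}. \<Sum>S | S \<in> ?P \<and> card S = i. (CARD('a) - 1) ^ card S)"
    using fin finD by (intro sum.group[symmetric]) auto
  also have "\<dots> = (\<Sum>i | i + 2 \<le> d. (card I choose i) * (CARD('a) - 1) ^ i)"
  proof (intro sum.cong refl)
    fix i assume i: "i \<in> {i. i + 2 \<le> d}"
    then have "{S. S \<in> ?P \<and> card S = i} = {S. S \<subseteq> I \<and> card S = i}" by auto
    then show "(\<Sum>S | S \<in> ?P \<and> card S = i. (CARD('a) - 1) ^ card S) =
        (card I choose i) * (CARD('a) - 1) ^ i"
      using n_subsets[OF assms, of i] by simp
  qed
  finally show ?thesis .
qed

text \<open>Deleting the zero coefficients of a combination leaves a support of at most
  \<open>d - 2\<close> indices on which every coefficient is nonzero.\<close>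

lemma mem_small_combinationsI:
  fixes h :: "nat \<Rightarrow> 'a :: field vec"
  assumes J: "finite J" "J \<subseteq> I" "card J + 2 = d" and h: "h ` J \<subseteq> carrier_vec r"
    and v: "v \<in> LinearCombinations.module.span class_ring (module_vec TYPE('a) r) (h ` J)"
  shows "v \<in> small_combinations r d h I"
proof -
  obtain c where car: "v \<in> carrier_vec r"
    and c: "\<forall>i<r. v $ i = (\<Sum>l\<in>J. c l * h l $ i)"
    using v unfolding mem_span_image_iff[OF J(1) h] by (elim conjE exE)
  define S where "S = {l \<in> J. c l \<noteq> 0}"
  have "S \<subseteq> I" "card S + 2 \<le> d"
    using J card_mono[of J S] by (auto simp: S_def)
  moreover have "restrict c S \<in> S \<rightarrow>\<^sub>E (UNIV - {0})" by (auto simp: S_def)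
  moreover have "v = vec r (\<lambda>i. \<Sum>l\<in>S. restrict c S l * h l $ i)"
  proof (rule eq_vecI)
    fix i assume "i < dim_vec (vec r (\<lambda>i. \<Sum>l\<in>S. restrict c S l * h l $ i))"
    then have i: "i < r" by simp
    have "v $ i = (\<Sum>l\<in>J. c l * h l $ i)" using c i by simp
    also have "\<dots> = (\<Sum>l\<in>S. restrict c S l * h l $ i)"
      using J(1) by (intro sum.mono_neutral_cong_right) (auto simp: S_def)
    finally show "v $ i = vec r (\<lambda>i. \<Sum>l\<in>S. restrict c S l * h l $ i) $ i" using i by simp
  qed (use car in simp)
  ultimately show ?thesis unfolding small_combinations_def by blast
qed

text \<open>Gilbert-Varshamov argument: the vectors that violate independence are small
  combinations, and these are fewer than the \<open>CARD('a) ^ r\<close> vectors of length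
  \<open>r\<close>.\<close>

lemma exists_indep_of_any:
  fixes h :: "nat \<Rightarrow> 'a :: {field, finite} vec"
  assumes I: "finite I" and h: "h ` I \<subseteq> carrier_vec r"
    and less: "(\<Sum>i | i + 2 \<le> d. (card I choose i) * (CARD('a) - 1) ^ i) < CARD('a) ^ r"
  shows "\<exists>v\<in>carrier_vec r. indep_of_any r d h I v"
proof -
  have "card (small_combinations r d h I) < card (carrier_vec r :: 'a vec set)"
    using card_small_combinations_le[OF I, of r d h] less by (simp add: card_carrier_vec)
  moreover have "finite (small_combinations r d h I)"
    by (rule finite_subset[of _ "carrier_vec r"]) (auto simp: small_combinations_def)
  ultimately obtain v where v: "v \<in> carrier_vec r" "v \<notin> small_combinations r d h I"
    by (meson card_mono not_le subsetI)
  have "indep_of_any r d h I v"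
    unfolding indep_of_any_def
  proof (intro allI impI notI)
    fix J assume J: "J \<subseteq> I" "card J + 2 = d"
      and "v \<in> LinearCombinations.module.span class_ring (module_vec TYPE('a) r) (h ` J)"
    then have "v \<in> small_combinations r d h I"
      using finite_subset[OF J(1) I] h by (intro mem_small_combinationsI) auto
    with v show False by blast
  qed
  with v show ?thesis by blast
qed

lemma exists_greedy_columns:
  assumes less: "(\<Sum>i | i + 2 \<le> d. ((m - 1) choose i) * (CARD('a) - 1) ^ i) < CARD('a :: {field, finite}) ^ r"
    and "r \<le> m"
  shows "\<exists>h :: nat \<Rightarrow> 'a vec. greedy_columns r d m h"
  using \<open>r \<le> m\<close> less
proof (induction m rule: dec_induct)
  case base
  have "greedy_columns r d r (\<lambda>l. col (1\<^sub>m r) (l - 1) :: 'a vec)"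
    by (simp add: greedy_columns_def)
  then show ?case by blast
next
  case (step m)
  let ?N = "\<lambda>m. \<Sum>i | i + 2 \<le> d. (m choose i) * (CARD('a) - 1) ^ i"
  \<comment> \<open>The bound for \<open>Suc m\<close> counts \<open>m\<close> earlier columns,
    which is what the new column needs. Being monotone, it implies the bound that the induction
    hypothesis requires.\<close>
  have "?N (m - 1) \<le> ?N m"
    by (intro sum_mono mult_right_mono binomial_right_mono) auto
  then obtain h :: "nat \<Rightarrow> 'a vec" where h: "greedy_columns r d m h"
    using step by auto
  then have "h ` {1..m} \<subseteq> carrier_vec r" using greedy_columns_carrier by blast
  then obtain v where "v \<in> carrier_vec r" "indep_of_any r d h {1..m} v"
    using exists_indep_of_any[of "{1..m}" h r d] step by auto
  with h step show ?case using greedy_columns_Suc by blast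
qed

text \<open>If \<open>d \<ge> r + 2\<close>, the sum contains all terms with
  \<open>i \<le> r\<close>. As \<open>r \<le> n - 1\<close>, these dominate the binomial expansion
  of \<open>((q - 1) + 1) ^ r\<close>, against the strict inequality.\<close>

lemma distance_bound_of_sum_less:
  fixes q n r d :: nat
  assumes "(\<Sum>i | i + 2 \<le> d. ((n - 1) choose i) * (q - 1) ^ i) < q ^ r"
    and "r < n" and "0 < q"
  shows "d \<le> r + 1"
proof (rule ccontr)
  assume "\<not> ?thesis"
  then have sub: "{..r} \<subseteq> {i. i + 2 \<le> d}" by auto
  have fin: "finite {i. i + 2 \<le> d}" by (rule finite_subset[of _ "{..d}"]) auto
  have "q ^ r = ((q - 1) + 1) ^ r" using \<open>0 < q\<close> by simp
  also have "\<dots> = (\<Sum>i\<le>r. (r choose i) * (q - 1) ^ i)"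
    unfolding binomial_ring by simp
  also have "\<dots> \<le> (\<Sum>i\<le>r. ((n - 1) choose i) * (q - 1) ^ i)"
    using \<open>r < n\<close> by (intro sum_mono mult_right_mono binomial_right_mono) auto
  also have "\<dots> \<le> (\<Sum>i | i + 2 \<le> d. ((n - 1) choose i) * (q - 1) ^ i)"
    by (rule sum_mono2[OF fin sub]) simp
  finally show False using assms(1) by simp
qed

section \<open>Codes with a prescribed minimum distance\<close>

lemma eq_of_add_smult_minus_one_eq_zero:
  fixes u v :: "'a :: comm_ring_1 vec"
  assumes "u \<in> carrier_vec n" "v \<in> carrier_vec n" and eq: "u + (-1) \<cdot>\<^sub>v v = 0\<^sub>v n"
  shows "u = v"
proof (rule eq_vecI)
  fix i assume "i < dim_vec v"
  then show "u $ i = v $ i"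
    using assms(1,2) arg_cong[OF eq, of "\<lambda>w. w $ i"] by auto
qed (use assms in auto)

text \<open>Otherwise the first coordinate would be injective on the subspace, leaving room for at
  most \<open>CARD('a)\<close> words, fewer than \<open>CARD('a) ^ k\<close>.\<close>

lemma exists_zero_first_coordinate:
  fixes C :: "'a :: {field, finite} vec set"
  assumes C: "linear_code n k C" and "2 \<le> k" and "0 < n"
  shows "\<exists>c\<in>C. c \<noteq> 0\<^sub>v n \<and> c $ 0 = 0"
proof (rule ccontr)
  assume none: "\<not> ?thesis"
  have sub: "subspace class_ring C (module_vec TYPE('a) n)" and card: "card C = CARD('a) ^ k"
    using C by (auto simp: linear_code_iff_card)
  note sub' = sub[unfolded subspace_module_vec_iff]
  have "inj_on (\<lambda>c. c $ 0) C"
  proof (rule inj_onI)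
    fix u v assume uv: "u \<in> C" "v \<in> C" "u $ 0 = v $ 0"
    then have car: "u \<in> carrier_vec n" "v \<in> carrier_vec n" using sub' by auto
    have "u + (-1) \<cdot>\<^sub>v v \<in> C" using sub' uv by blast
    moreover have "(u + (-1) \<cdot>\<^sub>v v) $ 0 = 0" using uv car \<open>0 < n\<close> by auto
    ultimately show "u = v" using none eq_of_add_smult_minus_one_eq_zero[OF car] by blast
  qed
  then have "card C \<le> CARD('a)" by (rule card_inj_on_le) auto
  moreover have "CARD('a) ^ 1 < CARD('a) ^ k"
    using one_less_card_field[where 'a = 'a] \<open>2 \<le> k\<close> by (intro power_strict_increasing) auto
  ultimately show False using card by simp
qed

text \<open>Overwriting one coordinate after the other by the first one fixes the all-one vector and
  lowers the weight of a word by at most one per step; a nonzero word with first coordinate 0 ends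
  at weight 0, so the minimum weight passes through every value below the original one.\<close>

lemma exists_code_with_min_distance:
  fixes C :: "'a :: {field, finite} vec set"
  assumes C: "linear_code n k C" and k: "2 \<le> k" and n: "0 < n" and one: "all_one n \<in> C"
    and d: "0 < d" "d \<le> min_distance C"
  shows "\<exists>C' :: 'a vec set. linear_code n k C' \<and> all_one n \<in> C' \<and> min_distance C' = d"
proof -
  have sub: "subspace class_ring C (module_vec TYPE('a) n)" and card: "card C = CARD('a) ^ k"
    using C by (auto simp: linear_code_iff_card)
  note sub' = sub[unfolded subspace_module_vec_iff]
  have carC: "c \<in> carrier_vec n" if "c \<in> C" for c using that sub' by blast
  define p where "p t c = vec n (\<lambda>i. if i < t then c $ 0 else c $ i)" for t and c :: "'a vec"
  obtain z where z: "z \<in> C" "z \<noteq> 0\<^sub>v n" "z $ 0 = 0"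
    using exists_zero_first_coordinate[OF C k n] by blast
  have p0: "p 0 c = c" if "c \<in> C" for c
    using carC[OF that] by (intro eq_vecI) (auto simp: p_def)
  have step: "weight (p t c) \<le> weight (p (Suc t) c) + 1" for t c
  proof -
    have "{i. i < n \<and> p t c $ i \<noteq> 0} \<subseteq> insert t {i. i < n \<and> p (Suc t) c $ i \<noteq> 0}"
      by (auto simp: p_def split: if_splits)
    then have "card {i. i < n \<and> p t c $ i \<noteq> 0} \<le> card (insert t {i. i < n \<and> p (Suc t) c $ i \<noteq> 0})"
      by (intro card_mono) auto
    also have "\<dots> \<le> card {i. i < n \<and> p (Suc t) c $ i \<noteq> 0} + 1"
      by (simp add: card_insert_if)
    finally show ?thesis by (simp add: weight_def p_def)
  qed
  define P where "P t \<longleftrightarrow> (\<exists>c\<in>C. c \<noteq> 0\<^sub>v n \<and> weight (p t c) \<le> d)" for t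
  have "p n z = 0\<^sub>v n" using z(3) by (intro eq_vecI) (auto simp: p_def)
  then have "weight (p n z) = 0" by (simp add: weight_eq_0_iff)
  then have "P n" unfolding P_def using z by force
  define t where "t = (LEAST t. P t)"
  have "P t" unfolding t_def using \<open>P n\<close> by (rule LeastI)
  then obtain c0 where c0: "c0 \<in> C" "c0 \<noteq> 0\<^sub>v n" "weight (p t c0) \<le> d" by (auto simp: P_def)
  \<comment> \<open>At the least \<open>t\<close> no weight has dropped below \<open>d\<close>: for
    \<open>t = 0\<close> this is the hypothesis on \<open>C\<close>, and otherwise the images of all
    nonzero words had weight above \<open>d\<close> one step earlier.\<close>
  have ge: "d \<le> weight (p t c)" if c: "c \<in> C" "c \<noteq> 0\<^sub>v n" for c
  proof (cases t)
    case 0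
    then show ?thesis
      using d(2) le_min_distance_iff[OF sub, of d] c p0 by (metis singletonD subsetD)
  next
    case (Suc s)
    then have "\<not> P s" using not_less_Least[of s P] by (simp add: t_def)
    then have "d < weight (p s c)" using c by (force simp: P_def)
    then show ?thesis using step[of s c] Suc by simp
  qed
  have add: "p t (u + v) = p t u + p t v" if "u \<in> C" "v \<in> C" for u v
    using carC[OF that(1)] carC[OF that(2)] n by (intro eq_vecI) (auto simp: p_def)
  have smult: "p t (a \<cdot>\<^sub>v v) = a \<cdot>\<^sub>v p t v" if "v \<in> C" for a v
    using carC[OF that] n by (intro eq_vecI) (auto simp: p_def)
  have pz: "p t (0\<^sub>v n) = 0\<^sub>v n" using n by (intro eq_vecI) (auto simp: p_def)
  have one': "p t (all_one n) = all_one n" using n by (intro eq_vecI) (auto simp: p_def all_one_def)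
  \<comment> \<open>As \<open>d\<close> is positive, no nonzero word is sent to zero. Hence the map
    is injective on \<open>C\<close> and the dimension stays \<open>k\<close>.\<close>
  have nz: "p t c \<noteq> 0\<^sub>v n" if "c \<in> C" "c \<noteq> 0\<^sub>v n" for c
    using ge[OF that] d(1) weight_eq_0_iff[of "p t c"] by (auto simp: p_def)
  have inj: "inj_on (p t) C"
  proof (rule inj_onI)
    fix u v assume uv: "u \<in> C" "v \<in> C" "p t u = p t v"
    have mem: "(-1) \<cdot>\<^sub>v v \<in> C" "u + (-1) \<cdot>\<^sub>v v \<in> C" using sub' uv by blast+
    have "p t (u + (-1) \<cdot>\<^sub>v v) = p t v + (-1) \<cdot>\<^sub>v p t v"
      using add[OF uv(1) mem(1)] smult[OF uv(2)] uv(3) by simp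
    also have "\<dots> = 0\<^sub>v n" by (intro eq_vecI) (auto simp: p_def)
    finally have "u + (-1) \<cdot>\<^sub>v v = 0\<^sub>v n" using nz[OF mem(2)] by blast
    then show "u = v" using eq_of_add_smult_minus_one_eq_zero carC uv(1,2) by blast
  qed
  have "subspace class_ring (p t ` C) (module_vec TYPE('a) n)"
    unfolding subspace_module_vec_iff
  proof (intro conjI ballI allI)
    show "p t ` C \<subseteq> carrier_vec n" by (auto simp: p_def)
    show "0\<^sub>v n \<in> p t ` C" using pz sub' by (metis imageI)
    show "u + v \<in> p t ` C" if "u \<in> p t ` C" "v \<in> p t ` C" for u v
      using that add sub' by (auto simp flip: add)
    show "a \<cdot>\<^sub>v v \<in> p t ` C" if "v \<in> p t ` C" for a v
      using that smult sub' by (auto simp flip: smult)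
  qed
  moreover from this have "min_distance (p t ` C) = d"
  proof (rule min_distance_eqI)
    show "d \<le> weight c" if "c \<in> p t ` C" "c \<noteq> 0\<^sub>v n" for c
      using that ge pz by auto
    show "p t c0 \<in> p t ` C" "p t c0 \<noteq> 0\<^sub>v n" "weight (p t c0) = d"
      using c0 ge nz by (auto intro: antisym)
  qed
  moreover have "all_one n \<in> p t ` C" using one one' by (metis imageI)
  ultimately show ?thesis
    using card_image[OF inj] card by (auto simp: linear_code_iff_card)
qed

lemma repetition_code:
  assumes "0 < n"
  defines "C \<equiv> range (\<lambda>a :: 'a :: {field, finite}. vec n (\<lambda>_. a))"
  shows "linear_code n 1 C" "min_distance C = n" "all_one n \<in> C"
proof -
  have sub: "subspace class_ring C (module_vec TYPE('a) n)"
    unfolding subspace_module_vec_iff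
  proof (intro conjI ballI allI)
    show "C \<subseteq> carrier_vec n" by (auto simp: C_def)
    have "0\<^sub>v n = vec n (\<lambda>_. 0 :: 'a)" by auto
    then show "0\<^sub>v n \<in> C" by (auto simp: C_def)
    fix u v assume "u \<in> C" "v \<in> C"
    then obtain a b where "u = vec n (\<lambda>_. a)" "v = vec n (\<lambda>_. b)" by (auto simp: C_def)
    then have "u + v = vec n (\<lambda>_. a + b)" by auto
    then show "u + v \<in> C" by (auto simp: C_def)
  next
    fix x v assume "v \<in> C"
    then obtain a where "v = vec n (\<lambda>_. a)" by (auto simp: C_def)
    then have "x \<cdot>\<^sub>v v = vec n (\<lambda>_. x * a)" by auto
    then show "x \<cdot>\<^sub>v v \<in> C" by (auto simp: C_def)
  qed
  have "inj (\<lambda>a :: 'a. vec n (\<lambda>_. a))"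
    using \<open>0 < n\<close> by (intro injI) (auto simp: vec_eq_iff)
  then have "card C = CARD('a)" unfolding C_def by (rule card_image)
  with sub show "linear_code n 1 C" by (simp add: linear_code_iff_card)
  show one: "all_one n \<in> C" by (simp add: C_def all_one_def)
  have w: "weight c = n" if "c \<in> C" "c \<noteq> 0\<^sub>v n" for c
  proof -
    obtain a where a: "c = vec n (\<lambda>_. a)" using \<open>c \<in> C\<close> by (auto simp: C_def)
    then have "a \<noteq> 0" using that(2) by (auto simp: vec_eq_iff)
    then have "{i. i < dim_vec c \<and> c $ i \<noteq> 0} = {..<n}" using a by auto
    then show ?thesis by (simp add: weight_def)
  qed
  have "all_one n \<noteq> (0\<^sub>v n :: 'a vec)" using \<open>0 < n\<close> by (auto simp: all_one_def vec_eq_iff)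
  with one w show "min_distance C = n" by (intro min_distance_eqI[OF sub, of _ "all_one n"]) auto
qed

text \<open>Nonzero words have weight \<open>d\<close>, \<open>n - d\<close> or \<open>n\<close>,
  according to which block vanishes, and \<open>2 * d \<le> n\<close> makes \<open>d\<close> the
  least of these.\<close>

lemma two_block_code:
  assumes "0 < d" "2 * d \<le> n"
  defines "C \<equiv> range (\<lambda>(a :: 'a :: {field, finite}, b). vec n (\<lambda>i. if i < d then a else b))"
  shows "linear_code n 2 C" "min_distance C = d" "all_one n \<in> C"
proof -
  let ?f = "\<lambda>(a :: 'a) b. vec n (\<lambda>i. if i < d then a else b)"
  have mem: "v \<in> C \<longleftrightarrow> (\<exists>a b. v = ?f a b)" for v by (auto simp: C_def)
  have sub: "subspace class_ring C (module_vec TYPE('a) n)"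
    unfolding subspace_module_vec_iff
  proof (intro conjI ballI allI)
    show "C \<subseteq> carrier_vec n" by (auto simp: mem)
    have "0\<^sub>v n = ?f 0 0" by (intro eq_vecI) auto
    then show "0\<^sub>v n \<in> C" unfolding mem by blast
    fix u v assume "u \<in> C" "v \<in> C"
    then obtain a b a' b' where "u = ?f a b" "v = ?f a' b'" by (auto simp: mem)
    then have "u + v = ?f (a + a') (b + b')" by (intro eq_vecI) auto
    then show "u + v \<in> C" unfolding mem by blast
  next
    fix x v assume "v \<in> C"
    then obtain a b where "v = ?f a b" by (auto simp: mem)
    then have "x \<cdot>\<^sub>v v = ?f (x * a) (x * b)" by (intro eq_vecI) auto
    then show "x \<cdot>\<^sub>v v \<in> C" unfolding mem by blast
  qed
  \<comment> \<open>Position 0 lies in the first block and position \<open>d\<close> in the second;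
    both blocks are nonempty because \<open>0 < d\<close> and \<open>d < n\<close>.\<close>
  have first: "?f a b $ 0 = a" and last: "?f a b $ d = b" for a b
    using assms by auto
  have "inj (\<lambda>(a, b). ?f a b)"
  proof (rule injI, clarify)
    fix a b a' b' assume "?f a b = ?f a' b'"
    then show "a = a' \<and> b = b'" using first last by metis
  qed
  then have "card C = CARD('a \<times> 'a)" unfolding C_def by (rule card_image)
  also have "\<dots> = CARD('a) ^ 2" by (simp add: power2_eq_square)
  finally show "linear_code n 2 C" using sub by (simp add: linear_code_iff_card)
  have "all_one n = ?f 1 1" by (intro eq_vecI) (auto simp: all_one_def)
  then show "all_one n \<in> C" unfolding mem by blast
  have w: "weight (?f a b) = (if a = 0 then 0 else d) + (if b = 0 then 0 else n - d)" for a b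
  proof -
    have "{i. i < n \<and> ?f a b $ i \<noteq> 0} =
        (if a = 0 then {} else {..<d}) \<union> (if b = 0 then {} else {d..<n})"
      using assms by (auto split: if_splits)
    moreover have "weight (?f a b) = card {i. i < n \<and> ?f a b $ i \<noteq> 0}"
      by (simp add: weight_def)
    moreover have "card ((if a = 0 then {} else {..<d}) \<union> (if b = 0 then {} else {d..<n})) =
        card (if a = 0 then {} else {..<d}) + card (if b = 0 then {} else {d..<n})"
      by (rule card_Un_disjoint) auto
    ultimately show ?thesis by simp
  qed
  show "min_distance C = d"
  proof (rule min_distance_eqI[OF sub, of _ "?f 1 0"])
    fix c assume c: "c \<in> C" "c \<noteq> 0\<^sub>v n"
    from c(1) obtain a b where ab: "c = ?f a b" unfolding mem by blast
    have "a \<noteq> 0 \<or> b \<noteq> 0" using c(2) unfolding ab by (auto simp: vec_eq_iff)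
    moreover have "d \<le> n - d" using assms(2) by simp
    ultimately have "d \<le> (if a = 0 then 0 else d) + (if b = 0 then 0 else n - d)"
      by (cases "a = 0"; cases "b = 0"; simp)
    then have "d \<le> weight (?f a b)" using w[of a b] by (rule ord_le_eq_trans[OF _ sym])
    then show "d \<le> weight c" by (subst ab)
  next
    show "?f 1 0 \<in> C" unfolding mem by blast
    show "weight (?f 1 0) = d" using w[of 1 0] by simp
    then show "?f 1 0 \<noteq> 0\<^sub>v n"
      using \<open>0 < d\<close> weight_eq_0_iff[of "?f 1 0"] by (metis dim_vec less_irrefl)
  qed
qed

section \<open>The kernel of a matrix of rescaled columns\<close>

lemma card_mat_kernel_ge:
  fixes A :: "'a :: {field, finite} mat"
  assumes A: "A \<in> carrier_mat nr nc"
  shows "CARD('a) ^ nc \<le> card (mat_kernel A) * CARD('a) ^ nr"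
proof -
  let ?V = "carrier_vec nc :: 'a vec set"
  \<comment> \<open>Counting form of rank-nullity: each nonempty fibre of multiplication by
    \<open>A\<close> is translated injectively into the kernel, and there are at most
    \<open>CARD('a) ^ nr\<close> such fibres.\<close>
  have fib: "card {x \<in> ?V. A *\<^sub>v x = A *\<^sub>v y} \<le> card (mat_kernel A)" if "y \<in> ?V" for y
  proof (rule card_inj_on_le[where f = "\<lambda>x. x - y"])
    show "inj_on (\<lambda>x. x - y) {x \<in> ?V. A *\<^sub>v x = A *\<^sub>v y}"
    proof (rule inj_onI)
      fix x x' assume xs: "x \<in> {x \<in> ?V. A *\<^sub>v x = A *\<^sub>v y}" "x' \<in> {x \<in> ?V. A *\<^sub>v x = A *\<^sub>v y}"
        and eq: "x - y = x' - y"
      show "x = x'"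
      proof (rule eq_vecI)
        fix i assume "i < dim_vec x'"
        then show "x $ i = x' $ i"
          using xs \<open>y \<in> ?V\<close> arg_cong[OF eq, of "\<lambda>v. v $ i"] by auto
      qed (use xs in auto)
    qed
    have "A *\<^sub>v (x - y) = 0\<^sub>v nr" if "x \<in> ?V" "A *\<^sub>v x = A *\<^sub>v y" for x
      using mult_minus_distrib_mat_vec[OF A that(1) \<open>y \<in> ?V\<close>] that A
      by (metis mult_mat_vec_carrier minus_cancel_vec)
    then show "(\<lambda>x. x - y) ` {x \<in> ?V. A *\<^sub>v x = A *\<^sub>v y} \<subseteq> mat_kernel A"
      using that by (auto simp: mat_kernel[OF A])
    show "finite (mat_kernel A)"
      using mat_kernel_carrier[OF A] finite_subset finite_carrier_vec by blast
  qed
  have im: "(*\<^sub>v) A ` ?V \<subseteq> carrier_vec nr" using A by auto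
  have "CARD('a) ^ nc = (\<Sum>x\<in>?V. 1)" by (simp add: card_carrier_vec)
  also have "\<dots> = (\<Sum>z\<in>(*\<^sub>v) A ` ?V. card {x \<in> ?V. A *\<^sub>v x = z})"
    by (subst sum.image_gen[of ?V _ "(*\<^sub>v) A"]) simp_all
  also have "\<dots> \<le> (\<Sum>z\<in>(*\<^sub>v) A ` ?V. card (mat_kernel A))"
    using fib by (intro sum_mono) auto
  also have "\<dots> \<le> card (mat_kernel A) * CARD('a) ^ nr"
    using card_mono[OF finite_carrier_vec im] by (simp add: card_carrier_vec)
  finally show ?thesis .
qed

text \<open>A common form for both outcomes of the construction: \<open>ls\<close> lists the columns
  that are kept and \<open>s\<close> gives their factors. The vanishing column sum puts the all-one
  vector into the kernel; counting the kernel bounds \<open>k'\<close> from below, and the identity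
  columns bound it from above.\<close>

lemma code_of_scaled_columns:
  fixes h :: "nat \<Rightarrow> 'a :: {field, finite} vec" and s :: "nat \<Rightarrow> 'a"
  assumes h: "greedy_columns r d m h" and rm: "r \<le> m" and dr: "d \<le> r + 1"
    and ls: "distinct ls" "set ls \<subseteq> {1..m}" "ls \<noteq> []"
    and s: "\<And>l. l \<in> set ls \<Longrightarrow> s l \<noteq> 0"
    and rel: "\<And>i. i < r \<Longrightarrow> (\<Sum>l\<in>set ls. s l * h l $ i) = 0"
  defines "C \<equiv> mat_kernel (mat_of_cols r (map (\<lambda>l. s l \<cdot>\<^sub>v h l) ls))"
  shows "\<exists>k'. linear_code (length ls) k' C \<and> d \<le> min_distance C \<and> all_one (length ls) \<in> C \<and>
    length ls \<le> k' + r \<and> k' + r \<le> m"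
proof -
  define N where "N = length ls"
  let ?vs = "map (\<lambda>l. s l \<cdot>\<^sub>v h l) ls"
  let ?H = "mat_of_cols r ?vs"
  have H: "?H \<in> carrier_mat r N" by (simp add: mat_of_cols_def N_def)
  have car: "h l \<in> carrier_vec r" if "l \<in> set ls" for l
    using greedy_columns_carrier[OF h] ls(2) that by blast
  have vs: "set ?vs \<subseteq> carrier_vec r" using car by auto
  have mem: "x \<in> C \<longleftrightarrow> x \<in> carrier_vec N \<and>
      (\<forall>i<r. (\<Sum>j<N. x $ j * (s (ls ! j) * h (ls ! j) $ i)) = 0)" for x
  proof -
    have "(\<Sum>j<N. x $ j * ?vs ! j $ i) = (\<Sum>j<N. x $ j * (s (ls ! j) * h (ls ! j) $ i))"
      if "i < r" for i
    proof (intro sum.cong refl)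
      fix j assume "j \<in> {..<N}"
      then have "j < length ls" "ls ! j \<in> set ls" by (simp_all add: N_def)
      then show "x $ j * ?vs ! j $ i = x $ j * (s (ls ! j) * h (ls ! j) $ i)"
        using that carrier_vecD[OF car[of "ls ! j"]] by simp
    qed
    then show ?thesis
      using mem_mat_kernel_mat_of_cols_iff[OF vs, of x] by (simp add: C_def N_def)
  qed
  have carC: "x \<in> carrier_vec N" if "x \<in> C" for x using mem that by blast
  have bij: "bij_betw ((!) ls) {..<N} (set ls)"
    using bij_betw_nth[OF ls(1), of "{..<N}" "set ls"] by (simp add: N_def)
  define pos where "pos = inv_into {..<N} ((!) ls)"
  have pos: "pos (ls ! j) = j" if "j < N" for j
    unfolding pos_def using that bij by (intro inv_into_f_f) (auto simp: bij_betw_def)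
  \<comment> \<open>A word becomes the coefficient family of a relation between \<open>h 1\<close>,
    ..., \<open>h m\<close>: the factors are absorbed and omitted indices get coefficient 0.\<close>
  define e where "e x l = (if l \<in> set ls then s l * x $ pos l else 0)" for x l
  have e_nth: "e x (ls ! j) = s (ls ! j) * x $ j" if "j < N" for x j
    using that pos[OF that] by (simp add: e_def N_def)
  have e_rel: "(\<Sum>l\<in>{1..m}. e x l * h l $ i) = 0" if "x \<in> C" "i < r" for x i
  proof -
    have "(\<Sum>l\<in>{1..m}. e x l * h l $ i) = (\<Sum>l\<in>set ls. e x l * h l $ i)"
      using ls(2) by (intro sum.mono_neutral_right) (auto simp: e_def)
    also have "\<dots> = (\<Sum>j<N. e x (ls ! j) * h (ls ! j) $ i)"
      by (rule sum.reindex_bij_betw[OF bij, symmetric])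
    also have "\<dots> = (\<Sum>j<N. x $ j * (s (ls ! j) * h (ls ! j) $ i))"
      by (intro sum.cong refl) (simp add: e_nth)
    finally show ?thesis using that mem by simp
  qed
  have e_support: "card {l \<in> {1..m}. e x l \<noteq> 0} = weight x" if "x \<in> C" for x
  proof -
    have dim: "dim_vec x = N" using carC[OF that] by simp
    \<comment> \<open>The factors are nonzero, so the support of \<open>x\<close> is carried onto
      that of \<open>e x\<close>.\<close>
    have "bij_betw ((!) ls) {j. j < N \<and> x $ j \<noteq> 0} {l \<in> {1..m}. e x l \<noteq> 0}"
    proof (rule bij_betw_imageI)
      show "inj_on ((!) ls) {j. j < N \<and> x $ j \<noteq> 0}"
        using bij by (auto simp: bij_betw_def intro: inj_on_subset)
      show "(!) ls ` {j. j < N \<and> x $ j \<noteq> 0} = {l \<in> {1..m}. e x l \<noteq> 0}"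
      proof (intro equalityI subsetI)
        fix l assume "l \<in> (!) ls ` {j. j < N \<and> x $ j \<noteq> 0}"
        then obtain j where j: "j < N" "x $ j \<noteq> 0" "l = ls ! j" by blast
        then have "l \<in> set ls" by (simp add: N_def)
        then show "l \<in> {l \<in> {1..m}. e x l \<noteq> 0}"
          using j e_nth[of j x] s ls(2) by auto
      next
        fix l assume l: "l \<in> {l \<in> {1..m}. e x l \<noteq> 0}"
        then have "l \<in> set ls" by (auto simp: e_def split: if_splits)
        then obtain j where j: "j < N" "l = ls ! j" by (auto simp: in_set_conv_nth N_def)
        then show "l \<in> (!) ls ` {j. j < N \<and> x $ j \<noteq> 0}"
          using l e_nth[of j x] by auto
      qed
    qed
    then show ?thesis by (simp add: weight_def dim bij_betw_same_card)
  qed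
  have sub: "subspace class_ring C (module_vec TYPE('a) N)"
    unfolding C_def by (rule subspace_mat_kernel[OF H])
  have finC: "finite C"
    using carC finite_subset[OF _ finite_carrier_vec, of C N] by blast
  have one: "all_one N \<in> C"
    unfolding mem
  proof (intro conjI allI impI)
    show "all_one N \<in> carrier_vec N" by (simp add: all_one_def)
    fix i assume "i < r"
    have "(\<Sum>j<N. all_one N $ j * (s (ls ! j) * h (ls ! j) $ i)) =
        (\<Sum>j<N. s (ls ! j) * h (ls ! j) $ i)"
      by (intro sum.cong refl) (simp add: all_one_def)
    also have "\<dots> = (\<Sum>l\<in>set ls. s l * h l $ i)"
      by (rule sum.reindex_bij_betw[OF bij])
    finally show "(\<Sum>j<N. all_one N $ j * (s (ls ! j) * h (ls ! j) $ i)) = 0"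
      using rel[OF \<open>i < r\<close>] by simp
  qed
  have N0: "0 < N" using ls(3) by (simp add: N_def)
  have one_ne: "all_one N \<noteq> (0\<^sub>v N :: 'a vec)"
    using N0 by (auto simp: all_one_def vec_eq_iff)
  have dist: "d \<le> min_distance C"
  proof (subst le_min_distance_iff[OF sub])
    show "\<not> C \<subseteq> {0\<^sub>v N}" using one one_ne by blast
    show "\<forall>c\<in>C. c \<noteq> 0\<^sub>v N \<longrightarrow> d \<le> weight c"
    proof (intro ballI impI)
      fix x assume x: "x \<in> C" "x \<noteq> 0\<^sub>v N"
      then have "weight x \<noteq> 0" using carC[OF x(1)] by (auto simp: weight_eq_0_iff)
      then have "{l \<in> {1..m}. e x l \<noteq> 0} \<noteq> {}"
        using e_support[OF x(1)] card.empty by metis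
      then obtain l where "l \<in> {1..m}" "e x l \<noteq> 0" by blast
      then have "d \<le> card {l \<in> {1..m}. e x l \<noteq> 0}"
        using greedy_columns_relation_support[OF h rm dr, of "e x"] e_rel[OF x(1)] by blast
      then show "d \<le> weight x" using e_support[OF x(1)] by simp
    qed
  qed
  obtain k' where lin: "linear_code N k' C" and card: "card C = CARD('a) ^ k'"
    using sub card_subspace_eq_power_dim[OF sub] by (auto simp: linear_code_def)
  note q = one_less_card_field[where 'a = 'a]
  have "N \<le> k' + r"
  proof -
    have "CARD('a) ^ N \<le> CARD('a) ^ (k' + r)"
      using card_mat_kernel_ge[OF H] card by (simp add: C_def power_add)
    then show ?thesis using q power_increasing_iff by blast
  qed
  moreover have "k' + r \<le> m"
  proof -
    \<comment> \<open>A relation is determined by its coefficients beyond \<open>r\<close>: because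
      of the identity part, row \<open>i\<close> expresses the coefficient of column
      \<open>i + 1\<close> through them.\<close>
    have "card C \<le> card ({r + 1..m} \<rightarrow>\<^sub>E (UNIV :: 'a set))"
    proof (rule card_inj_on_le[where f = "\<lambda>x. restrict (e x) {r + 1..m}"])
      show "inj_on (\<lambda>x. restrict (e x) {r + 1..m}) C"
      proof (rule inj_onI)
        fix x y assume xy: "x \<in> C" "y \<in> C"
          and "restrict (e x) {r + 1..m} = restrict (e y) {r + 1..m}"
        then have hi: "e x l = e y l" if "l \<in> {r + 1..m}" for l
          using that by (metis restrict_apply')
        have split: "(\<Sum>l\<in>{1..m}. e z l * h l $ i) = e z (i + 1) + (\<Sum>l\<in>{r + 1..m}. e z l * h l $ i)"
          if "i < r" for z i
        proof -
          have "{1..m} = {1..r} \<union> {r + 1..m}" using rm by auto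
          then have "(\<Sum>l\<in>{1..m}. e z l * h l $ i) =
              (\<Sum>l\<in>{1..r}. e z l * h l $ i) + (\<Sum>l\<in>{r + 1..m}. e z l * h l $ i)"
            by (simp add: sum.union_disjoint)
          also have "(\<Sum>l\<in>{1..r}. e z l * h l $ i) = (\<Sum>l\<in>{1..r}. if l = i + 1 then e z l else 0)"
            using that by (intro sum.cong refl) (auto simp: greedy_columns_identity[OF h])
          also have "\<dots> = e z (i + 1)" using that by simp
          finally show ?thesis .
        qed
        have lo: "e x (i + 1) = e y (i + 1)" if i: "i < r" for i
        proof -
          have "(\<Sum>l\<in>{r + 1..m}. e x l * h l $ i) = (\<Sum>l\<in>{r + 1..m}. e y l * h l $ i)"
            using hi by (intro sum.cong refl) simp
          then have "e x (i + 1) + (\<Sum>l\<in>{r + 1..m}. e y l * h l $ i) = 0"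
            and "e y (i + 1) + (\<Sum>l\<in>{r + 1..m}. e y l * h l $ i) = 0"
            using split[OF i, of x] split[OF i, of y] e_rel[OF xy(1) i] e_rel[OF xy(2) i] by simp_all
          then show ?thesis by (metis add_right_cancel)
        qed
        have all: "e x l = e y l" if l: "l \<in> {1..m}" for l
        proof (cases "l \<le> r")
          case True
          moreover have "l = (l - 1) + 1" using l by simp
          ultimately show ?thesis using lo[of "l - 1"] by (metis Suc_eq_plus1 Suc_le_lessD)
        next
          case False
          then show ?thesis using l hi by simp
        qed
        show "x = y"
        proof (rule eq_vecI)
          show "dim_vec x = dim_vec y" using carC[OF xy(1)] carC[OF xy(2)] by simp
          fix j assume "j < dim_vec y"
          then have j: "j < N" using carC[OF xy(2)] by simp
          then have "ls ! j \<in> set ls" by (simp add: N_def)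
          then show "x $ j = y $ j"
            using all[of "ls ! j"] e_nth[OF j] s[of "ls ! j"] ls(2) by (simp add: subset_eq)
        qed
      qed
    qed (auto intro: finite_PiE)
    also have "\<dots> = CARD('a) ^ (m - r)" by (simp add: card_PiE)
    finally have "CARD('a) ^ k' \<le> CARD('a) ^ (m - r)" using card by simp
    then have "k' \<le> m - r" using q power_increasing_iff by blast
    then show ?thesis using rm by simp
  qed
  ultimately show ?thesis using lin dist one by (auto simp: N_def)
qed

section \<open>Completing the greedy columns to a parity-check matrix\<close>

lemma exists_of_nat_eq:
  fixes a :: "'a :: {field, finite}"
  assumes "prime CARD('a)" and "a \<noteq> 0"
  shows "\<exists>m\<in>{1..CARD('a) - 1}. of_nat m = a"
proof -
  \<comment> \<open>The characteristic of the field divides its prime order and is not 1. Hence the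
    naturals below the order embed injectively, and by counting they exhaust the field.\<close>
  have char: "CHAR('a) = CARD('a)"
    using CHAR_dvd_CARD[where 'a = 'a] assms(1) by (auto simp: prime_nat_iff)
  have "inj_on (of_nat :: nat \<Rightarrow> 'a) {..<CARD('a)}"
    by (intro inj_onI) (auto simp: of_nat_eq_iff_cong_CHAR char cong_def)
  then have "card ((of_nat :: nat \<Rightarrow> 'a) ` {..<CARD('a)}) = card (UNIV :: 'a set)"
    by (simp add: card_image)
  then have "(of_nat :: nat \<Rightarrow> 'a) ` {..<CARD('a)} = UNIV"
    by (intro card_subset_eq) auto
  then obtain m where m: "m < CARD('a)" "of_nat m = a" by (metis UNIV_I imageE lessThan_iff)
  then have "m \<noteq> 0" using assms(2) by (metis of_nat_0)
  then show ?thesis using m by (intro bexI[of _ m]) auto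
qed

lemma index_neg_col_sum:
  fixes h :: "nat \<Rightarrow> 'a :: field vec"
  assumes "h ` {1..n} \<subseteq> carrier_vec r"
  shows "neg_col_sum r n h \<in> carrier_vec r"
    and "i < r \<Longrightarrow> neg_col_sum r n h $ i = - (\<Sum>l\<in>{1..n}. h l $ i)"
proof -
  have h: "h \<in> {1..n} \<rightarrow> carrier_vec r" using assms by auto
  show "neg_col_sum r n h \<in> carrier_vec r"
    unfolding neg_col_sum_def by (intro uminus_carrier_vec[THEN iffD2] finsum_vec_closed[OF h])
  show "neg_col_sum r n h $ i = - (\<Sum>l\<in>{1..n}. h l $ i)" if "i < r"
    using carrier_vecD[OF finsum_vec_closed[OF h]] index_finsum_vec[OF _ that h] that
    by (simp add: neg_col_sum_def)
qed

text \<open>In the dependent case a representation of the negated column sum by \<open>d - 2\<close>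
  columns is thinned out to its nonzero coefficients; their indices are numbered from 1 to
  \<open>\<delta>\<close> and their values lifted to naturals.\<close>

lemma exists_completed_matrix:
  fixes h :: "nat \<Rightarrow> 'a :: {field, finite} vec"
  assumes q: "prime CARD('a)" and h: "h ` {1..n} \<subseteq> carrier_vec r"
  shows "\<exists>H. completed_matrix CARD('a) r d n h H"
proof (cases "indep_of_any r d h {1..n} (neg_col_sum r n h)")
  case True
  then show ?thesis by (simp add: completed_matrix_def Let_def)
next
  case False
  define p where "p = neg_col_sum r n h"
  obtain J where J: "J \<subseteq> {1..n}" "card J + 2 = d"
    and span: "p \<in> LinearCombinations.module.span class_ring (module_vec TYPE('a) r) (h ` J)"
    using False unfolding indep_of_any_def p_def by blast
  have finJ: "finite J" and hJ: "h ` J \<subseteq> carrier_vec r"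
    using J(1) h by (auto intro: finite_subset)
  obtain c where car: "p \<in> carrier_vec r" and c: "\<forall>i<r. p $ i = (\<Sum>l\<in>J. c l * h l $ i)"
    using span unfolding mem_span_image_iff[OF finJ hJ] by (elim conjE exE)
  define S where "S = {l \<in> J. c l \<noteq> 0}"
  have S: "finite S" "S \<subseteq> J" using finJ by (auto simp: S_def)
  define \<delta> where "\<delta> = card S"
  obtain f where f: "bij_betw f {1..\<delta>} S"
    using ex_bij_betw_nat_finite_1[OF S(1)] by (auto simp: \<delta>_def)
  have fS: "f j \<in> S" if "j \<in> {1..\<delta>}" for j using f that by (auto simp: bij_betw_def)
  have "\<forall>j\<in>{1..\<delta>}. \<exists>m. m \<in> {1..CARD('a) - 1} \<and> of_nat m = c (f j)"
    using exists_of_nat_eq[OF q] fS by (auto simp: S_def Bex_def)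
  then obtain a where a: "\<And>j. j \<in> {1..\<delta>} \<Longrightarrow> a j \<in> {1..CARD('a) - 1}"
    "\<And>j. j \<in> {1..\<delta>} \<Longrightarrow> of_nat (a j) = c (f j)"
    by metis
  have fh: "(\<lambda>j. of_nat (a j) \<cdot>\<^sub>v h (f j)) \<in> {1..\<delta>} \<rightarrow> carrier_vec r"
    using fS S(2) hJ by (auto simp: image_subset_iff subset_eq)
  have "p = finsum_vec TYPE('a) r (\<lambda>j. of_nat (a j) \<cdot>\<^sub>v h (f j)) {1..\<delta>}"
  proof (rule eq_vecI)
    note dim = carrier_vecD[OF finsum_vec_closed[OF fh]]
    show "dim_vec p = dim_vec (finsum_vec TYPE('a) r (\<lambda>j. of_nat (a j) \<cdot>\<^sub>v h (f j)) {1..\<delta>})"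
      using dim car by simp
    fix i assume "i < dim_vec (finsum_vec TYPE('a) r (\<lambda>j. of_nat (a j) \<cdot>\<^sub>v h (f j)) {1..\<delta>})"
    then have i: "i < r" using dim by simp
    have "p $ i = (\<Sum>l\<in>S. c l * h l $ i)"
      using c i finJ S by (auto simp: S_def intro!: sum.mono_neutral_right)
    also have "\<dots> = (\<Sum>j\<in>{1..\<delta>}. c (f j) * h (f j) $ i)"
      by (rule sum.reindex_bij_betw[OF f, symmetric])
    also have "\<dots> = (\<Sum>j\<in>{1..\<delta>}. (of_nat (a j) \<cdot>\<^sub>v h (f j)) $ i)"
    proof (intro sum.cong refl)
      fix j assume j: "j \<in> {1..\<delta>}"
      then have "dim_vec (h (f j)) = r" using fS S(2) hJ by (intro carrier_vecD) blast
      then show "c (f j) * h (f j) $ i = (of_nat (a j) \<cdot>\<^sub>v h (f j)) $ i"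
        using a(2)[OF j] i by simp
    qed
    also have "\<dots> = finsum_vec TYPE('a) r (\<lambda>j. of_nat (a j) \<cdot>\<^sub>v h (f j)) {1..\<delta>} $ i"
      using index_finsum_vec[OF _ i fh] by simp
    finally show "p $ i = finsum_vec TYPE('a) r (\<lambda>j. of_nat (a j) \<cdot>\<^sub>v h (f j)) {1..\<delta>} $ i" .
  qed
  moreover have "\<delta> + 2 \<le> d" using card_mono[OF finJ S(2)] J(2) by (simp add: \<delta>_def)
  moreover have "inj_on f {1..\<delta>}" "f ` {1..\<delta>} \<subseteq> {1..n}"
    using f S(2) J(1) by (auto simp: bij_betw_def)
  moreover have "\<forall>j\<in>{1..\<delta>}. a j \<in> {1..CARD('a) - 1}" using a(1) by blast
  ultimately have "completed_matrix CARD('a) r d n h (mat_of_cols r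
      (map h [l \<leftarrow> [1..<n+1]. l \<notin> f ` {1..\<delta>}] @
       map (\<lambda>j. of_nat (a j + 1) \<cdot>\<^sub>v h (f j)) [j \<leftarrow> [1..<\<delta>+1]. a j \<noteq> CARD('a) - 1]))"
    using False unfolding completed_matrix_def Let_def if_not_P[OF False] p_def by blast
  then show ?thesis by blast
qed

text \<open>Both branches instantiate \<open>code_of_scaled_columns\<close>: with factor 1 on
  \<open>h 1\<close>, ..., \<open>h n\<close> and \<open>p\<close>, or with factor
  \<open>b l + 1\<close> on \<open>h l\<close>, where \<open>b\<close> holds the coefficients of
  \<open>p\<close>. Either way the columns sum to 0.\<close>

lemma code_of_completed_matrix:
  fixes h :: "nat \<Rightarrow> 'a :: {field, finite} vec"
  assumes q: "prime CARD('a)" and h: "greedy_columns r d n h" and rn: "r \<le> n"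
    and d: "0 < d" "d \<le> r + 1" "d \<le> n"
    and H: "completed_matrix CARD('a) r d n h H"
  shows "\<exists>n' k'. linear_code n' k' (mat_kernel H) \<and> d \<le> min_distance (mat_kernel H) \<and>
    all_one n' \<in> mat_kernel H \<and> n + 2 \<le> n' + d \<and> n' \<le> n + 1 \<and>
    n + 2 \<le> k' + r + d \<and> k' + r \<le> n + 1"
proof -
  define p where "p = neg_col_sum r n h"
  have hcar: "h ` {1..n} \<subseteq> carrier_vec r" using greedy_columns_carrier[OF h] by blast
  note p = index_neg_col_sum[OF hcar, folded p_def]
  show ?thesis
  proof (cases "indep_of_any r d h {1..n} p")
    case True
    then have H: "H = mat_of_cols r (map h [1..<n+1] @ [p])"
      using H by (simp add: completed_matrix_def Let_def p_def)
    \<comment> \<open>The appended column is number \<open>n + 1\<close> of a greedy family, which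
      explains the upper bounds that exceed \<open>n\<close> and \<open>k\<close> by one.\<close>
    let ?h = "h(Suc n := p)"
    define ls where "ls = [1..<n + 1] @ [Suc n]"
    have ls: "distinct ls" "set ls = insert (Suc n) {1..n}" "ls \<noteq> []" "length ls = n + 1"
      by (auto simp: ls_def simp del: upt_Suc)
    have h': "greedy_columns r d (Suc n) ?h"
      by (rule greedy_columns_Suc[OF h rn p(1) True])
    have "map (\<lambda>l. 1 \<cdot>\<^sub>v ?h l) [1..<n + 1] = map h [1..<n + 1]" by (intro map_cong) auto
    then have map_ls: "map (\<lambda>l. 1 \<cdot>\<^sub>v ?h l) ls = map h [1..<n + 1] @ [p]"
      by (simp add: ls_def del: upt_Suc)
    have H': "H = mat_of_cols r (map (\<lambda>l. 1 \<cdot>\<^sub>v ?h l) ls)" unfolding map_ls by (rule H)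
    have rel: "(\<Sum>l\<in>set ls. 1 * ?h l $ i) = 0" if "i < r" for i
    proof -
      have "(\<Sum>l\<in>set ls. 1 * ?h l $ i) = p $ i + (\<Sum>l\<in>{1..n}. ?h l $ i)"
        by (simp add: ls(2))
      also have "(\<Sum>l\<in>{1..n}. ?h l $ i) = (\<Sum>l\<in>{1..n}. h l $ i)"
        by (intro sum.cong refl) auto
      finally show ?thesis using p(2)[OF that] by simp
    qed
    have "r \<le> Suc n" "set ls \<subseteq> {1..Suc n}" using rn ls(2) by auto
    then obtain k' where "linear_code (length ls) k' (mat_kernel H)" "d \<le> min_distance (mat_kernel H)"
      "all_one (length ls) \<in> mat_kernel H" "length ls \<le> k' + r" "k' + r \<le> Suc n"
      using code_of_scaled_columns[OF h' _ d(2) ls(1) _ ls(3) _ rel, folded H'] by auto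
    then show ?thesis
      using d(1) ls(4) by (intro exI[of _ "length ls"] exI[of _ k']) auto
  next
    case False
    obtain \<delta> and f a :: "nat \<Rightarrow> nat" where \<delta>: "\<delta> + 2 \<le> d" and f: "inj_on f {1..\<delta>}" "f ` {1..\<delta>} \<subseteq> {1..n}"
      and a: "\<forall>j\<in>{1..\<delta>}. a j \<in> {1..CARD('a) - 1}"
      and peq: "p = finsum_vec TYPE('a) r (\<lambda>j. of_nat (a j) \<cdot>\<^sub>v h (f j)) {1..\<delta>}"
      and H: "H = mat_of_cols r (map h [l \<leftarrow> [1..<n+1]. l \<notin> f ` {1..\<delta>}] @
        map (\<lambda>j. of_nat (a j + 1) \<cdot>\<^sub>v h (f j)) [j \<leftarrow> [1..<\<delta>+1]. a j \<noteq> CARD('a) - 1])"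
      using H False unfolding completed_matrix_def Let_def p_def by auto
    define g where "g = inv_into {1..\<delta>} f"
    have g: "g (f j) = j" if "j \<in> {1..\<delta>}" for j
      using f(1) that by (simp add: g_def)
    define b :: "nat \<Rightarrow> 'a" where "b l = (if l \<in> f ` {1..\<delta>} then of_nat (a (g l)) else 0)" for l
    \<comment> \<open>The columns \<open>s l \<cdot>\<^sub>v h l\<close> add up to \<open>p\<close>
      plus the sum of all \<open>h l\<close>, which is 0 by the choice of \<open>p\<close>.\<close>
    define s where "s l = b l + 1" for l
    define L where "L = [l \<leftarrow> [1..<n+1]. l \<notin> f ` {1..\<delta>}]"
    define M where "M = [j \<leftarrow> [1..<\<delta>+1]. a j \<noteq> CARD('a) - 1]"
    define ls where "ls = L @ map f M"
    have L: "distinct L" "set L = {1..n} - f ` {1..\<delta>}"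
      by (auto simp: L_def simp del: upt_Suc)
    have M: "distinct M" "set M = {j \<in> {1..\<delta>}. a j \<noteq> CARD('a) - 1}"
      by (auto simp: M_def simp del: upt_Suc)
    have s_f: "s (f j) = of_nat (a j + 1)" if "j \<in> {1..\<delta>}" for j
      using that g[OF that] by (simp add: s_def b_def)
    have s_out: "s l = 1" if "l \<notin> f ` {1..\<delta>}" for l using that by (simp add: s_def b_def)
    have s_eq_0: "s (f j) = 0 \<longleftrightarrow> a j = CARD('a) - 1" if "j \<in> {1..\<delta>}" for j
    proof -
      have char: "CHAR('a) = CARD('a)"
        using CHAR_dvd_CARD[where 'a = 'a] q by (auto simp: prime_nat_iff)
      have "a j \<in> {1..CARD('a) - 1}" using a that by blast
      \<comment> \<open>\<open>a j + 1\<close> lies between 2 and \<open>CARD('a)\<close>, so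
        divisibility forces equality.\<close>
      then have "CARD('a) dvd a j + 1 \<longleftrightarrow> a j = CARD('a) - 1"
        using q prime_gt_1_nat[OF q] by (auto dest: dvd_imp_le)
      then show ?thesis
        unfolding s_f[OF that] of_nat_eq_0_iff_char_dvd char .
    qed
    have mem_ls: "set ls = ({1..n} - f ` {1..\<delta>}) \<union> f ` {j \<in> {1..\<delta>}. a j \<noteq> CARD('a) - 1}"
      by (simp add: ls_def L M)
    \<comment> \<open>The deleted columns are those whose factor vanishes, so summing over
      \<open>ls\<close> instead of \<open>{1..n}\<close> changes nothing.\<close>
    have set_ls: "set ls = {l \<in> {1..n}. s l \<noteq> 0}"
    proof (intro equalityI subsetI)
      fix l assume "l \<in> set ls"
      then consider "l \<in> {1..n}" "l \<notin> f ` {1..\<delta>}"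
        | j where "j \<in> {1..\<delta>}" "a j \<noteq> CARD('a) - 1" "l = f j"
        unfolding mem_ls by blast
      then show "l \<in> {l \<in> {1..n}. s l \<noteq> 0}"
        using image_subset_iff[THEN iffD1, OF f(2)] s_eq_0 s_out by cases auto
    next
      fix l assume l: "l \<in> {l \<in> {1..n}. s l \<noteq> 0}"
      show "l \<in> set ls"
      proof (cases "l \<in> f ` {1..\<delta>}")
        case True
        then obtain j where j: "j \<in> {1..\<delta>}" "l = f j" by blast
        then have "a j \<noteq> CARD('a) - 1" using l s_eq_0[OF j(1)] by simp
        then show ?thesis using j unfolding mem_ls by blast
      next
        case False
        then show ?thesis using l unfolding mem_ls by blast
      qed
    qed
    have "inj_on f (set M)" using f(1) by (rule inj_on_subset) (auto simp: M)
    moreover have "set L \<inter> f ` set M = {}" by (auto simp: L M)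
    ultimately have dist: "distinct ls" by (simp add: ls_def distinct_map L(1) M(1))
    have "map (\<lambda>l. s l \<cdot>\<^sub>v h l) L = map h L"
      by (rule map_cong[OF refl]) (simp add: L(2) s_out)
    moreover have "map (\<lambda>l. s l \<cdot>\<^sub>v h l) (map f M) = map (\<lambda>j. of_nat (a j + 1) \<cdot>\<^sub>v h (f j)) M"
      unfolding map_map by (rule map_cong[OF refl]) (simp add: M(2) s_f)
    ultimately have "map (\<lambda>l. s l \<cdot>\<^sub>v h l) ls =
        map h L @ map (\<lambda>j. of_nat (a j + 1) \<cdot>\<^sub>v h (f j)) M"
      unfolding ls_def map_append by (rule arg_cong2)
    then have H': "H = mat_of_cols r (map (\<lambda>l. s l \<cdot>\<^sub>v h l) ls)"
      unfolding H L_def M_def by (rule arg_cong[OF sym])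
    have fh: "(\<lambda>j. of_nat (a j) \<cdot>\<^sub>v h (f j)) \<in> {1..\<delta>} \<rightarrow> carrier_vec r"
      using f(2) hcar by (auto simp: image_subset_iff)
    have rel: "(\<Sum>l\<in>set ls. s l * h l $ i) = 0" if i: "i < r" for i
    proof -
      have "(\<Sum>l\<in>set ls. s l * h l $ i) = (\<Sum>l\<in>{1..n}. s l * h l $ i)"
        by (intro sum.mono_neutral_left) (auto simp: set_ls)
      also have "\<dots> = (\<Sum>l\<in>{1..n}. b l * h l $ i) + (\<Sum>l\<in>{1..n}. h l $ i)"
        by (simp add: s_def distrib_right sum.distrib)
      also have "(\<Sum>l\<in>{1..n}. b l * h l $ i) = (\<Sum>l\<in>f ` {1..\<delta>}. b l * h l $ i)"
        using f(2) by (intro sum.mono_neutral_right) (auto simp: b_def)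
      also have "\<dots> = (\<Sum>j\<in>{1..\<delta>}. b (f j) * h (f j) $ i)"
        using f(1) by (simp add: sum.reindex)
      also have "\<dots> = (\<Sum>j\<in>{1..\<delta>}. (of_nat (a j) \<cdot>\<^sub>v h (f j)) $ i)"
      proof (intro sum.cong refl)
        fix j assume j: "j \<in> {1..\<delta>}"
        then have "dim_vec (h (f j)) = r" using f(2) hcar by (intro carrier_vecD) blast
        then show "b (f j) * h (f j) $ i = (of_nat (a j) \<cdot>\<^sub>v h (f j)) $ i"
          using g[OF j] j i by (simp add: b_def)
      qed
      also have "\<dots> = p $ i" unfolding peq using index_finsum_vec[OF _ i fh] by simp
      finally show ?thesis using p(2)[OF i] by simp
    qed
    \<comment> \<open>At most \<open>\<delta>\<close> columns are lost, and
      \<open>\<delta> + 2 \<le> d\<close>. This yields the lower bounds on length and dimension and,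
      with \<open>d \<le> n\<close>, at least one remaining column.\<close>
    have "{1..n} - f ` {1..\<delta>} \<subseteq> set ls" unfolding mem_ls by blast
    then have "card ({1..n} - f ` {1..\<delta>}) \<le> length ls"
      using card_mono[of "set ls"] distinct_card[OF dist] by simp
    moreover have "card ({1..n} - f ` {1..\<delta>}) = n - \<delta>"
      using f by (simp add: card_Diff_subset card_image)
    ultimately have len: "n \<le> length ls + \<delta>" by simp
    have sub: "set ls \<subseteq> {1..n}" using set_ls by blast
    then have len': "length ls \<le> n"
      using card_mono[of "{1..n}" "set ls"] distinct_card[OF dist] by simp
    have "ls \<noteq> []" using len \<delta> d(3) by auto
    then obtain k' where "linear_code (length ls) k' (mat_kernel H)"
      "d \<le> min_distance (mat_kernel H)" "all_one (length ls) \<in> mat_kernel H"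
      "length ls \<le> k' + r" "k' + r \<le> n"
      using code_of_scaled_columns[OF h rn d(2) dist sub _ _ rel] set_ls unfolding H' by auto
    then show ?thesis
      using len len' \<delta> by (intro exI[of _ "length ls"] exI[of _ k']) auto
  qed
qed

theorem theorem3:
  fixes q n k d :: nat
  assumes "prime q" and "card (UNIV :: 'a :: {field, finite} set) = q"
    and "0 < n" and "0 < k" and "k \<le> n" and "0 < d" and "d \<le> n"
    and "(\<Sum>i | i + 2 \<le> d. ((n - 1) choose i) * (q - 1) ^ i) < q ^ (n - k)"
  shows
    "(\<exists>n' k'. \<exists>C :: 'a vec set.
        linear_code n' k' C \<and> min_distance C = d \<and> all_one n' \<in> C \<and>
        n + 2 \<le> n' + d \<and> n' \<le> n + 1 \<and> k + 2 \<le> k' + d \<and> k' \<le> k + 1) \<and>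
     (\<forall>l\<in>{n - k + 1..n}.
        (\<Sum>i | i + 2 \<le> d. ((l - 1) choose i) * (q - 1) ^ i) < q ^ (n - k) \<and>
        (\<forall>h :: nat \<Rightarrow> 'a vec. greedy_columns (n - k) d (l - 1) h \<longrightarrow>
           (\<exists>v \<in> carrier_vec (n - k). indep_of_any (n - k) d h {1..<l} v))) \<and>
     (\<exists>h :: nat \<Rightarrow> 'a vec. greedy_columns (n - k) d n h) \<and>
     (\<forall>h :: nat \<Rightarrow> 'a vec. greedy_columns (n - k) d n h \<longrightarrow>
        (\<exists>H. completed_matrix q (n - k) d n h H) \<and>
        (\<forall>H. completed_matrix q (n - k) d n h H \<longrightarrow>
           (\<exists>n' k' C. parity_check_matrix H C \<and>
              linear_code n' k' C \<and> d \<le> min_distance C \<and> all_one n' \<in> C \<and>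
              n + 2 \<le> n' + d \<and> n' \<le> n + 1 \<and> k + 2 \<le> k' + d \<and> k' \<le> k + 1)))"
proof -
  define r where "r = n - k"
  have q: "prime CARD('a)" and qq: "CARD('a) = q" using assms(1,2) by simp_all
  have n: "n = r + k" and rn: "r < n" using assms by (simp_all add: r_def)
  note less = assms(8)[folded r_def]
  \<comment> \<open>The padding of supports to \<open>d - 2\<close> indices rests on this bound. It
    follows from the counting hypothesis because \<open>0 < k\<close> gives
    \<open>r < n\<close>.\<close>
  have dr: "d \<le> r + 1"
    using distance_bound_of_sum_less[OF less rn] prime_gt_0_nat[OF assms(1)] .
  have less_l: "(\<Sum>i | i + 2 \<le> d. ((l - 1) choose i) * (q - 1) ^ i) < q ^ r"
    if "l \<le> n" for l
  proof -
    have "(\<Sum>i | i + 2 \<le> d. ((l - 1) choose i) * (q - 1) ^ i) \<le>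
        (\<Sum>i | i + 2 \<le> d. ((n - 1) choose i) * (q - 1) ^ i)"
      using that by (intro sum_mono mult_right_mono binomial_right_mono) auto
    then show ?thesis using less by simp
  qed
  have column: "\<exists>v\<in>carrier_vec r. indep_of_any r d h {1..<l} v"
    if l: "l \<in> {r + 1..n}" and h: "greedy_columns r d (l - 1) h" for l and h :: "nat \<Rightarrow> 'a vec"
  proof (rule exists_indep_of_any)
    show "h ` {1..<l} \<subseteq> carrier_vec r" using greedy_columns_carrier[OF h] by auto
    show "(\<Sum>i | i + 2 \<le> d. (card {1..<l} choose i) * (CARD('a) - 1) ^ i) < CARD('a) ^ r"
      using less_l[of l] l qq by simp
  qed simp
  have greedy: "\<exists>h :: nat \<Rightarrow> 'a vec. greedy_columns r d n h"
    by (rule exists_greedy_columns) (use less rn qq in simp_all)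
  have completed: "\<exists>H. completed_matrix q r d n h H" if "greedy_columns r d n h" for h :: "nat \<Rightarrow> 'a vec"
    using exists_completed_matrix[OF q, of h n r d] greedy_columns_carrier[OF that] qq by blast
  have code: "\<exists>n' k' C. parity_check_matrix H C \<and>
      linear_code n' k' C \<and> d \<le> min_distance C \<and> all_one n' \<in> C \<and>
      n + 2 \<le> n' + d \<and> n' \<le> n + 1 \<and> k + 2 \<le> k' + d \<and> k' \<le> k + 1"
    if h: "greedy_columns r d n h" and H: "completed_matrix q r d n h H"
    for h :: "nat \<Rightarrow> 'a vec" and H
  proof -
    obtain n' k' where "linear_code n' k' (mat_kernel H)" "d \<le> min_distance (mat_kernel H)"
      "all_one n' \<in> mat_kernel H" "n + 2 \<le> n' + d" "n' \<le> n + 1"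
      "n + 2 \<le> k' + r + d" "k' + r \<le> n + 1"
      using code_of_completed_matrix[OF q h _ assms(6) dr assms(7), of H] H rn qq by force
    then show ?thesis
      using n unfolding parity_check_matrix_def
      by (intro exI[of _ n'] exI[of _ k'] exI[of _ "mat_kernel H"]) auto
  qed
  have exact: "\<exists>n' k'. \<exists>C :: 'a vec set.
      linear_code n' k' C \<and> min_distance C = d \<and> all_one n' \<in> C \<and>
      n + 2 \<le> n' + d \<and> n' \<le> n + 1 \<and> k + 2 \<le> k' + d \<and> k' \<le> k + 1"
  proof -
    \<comment> \<open>For \<open>k < d\<close> the lower bound on the dimension is at most 1, so the
      dimensions 1 and 2 are both allowed. Length \<open>n + 1\<close> then suits the two-block code
      if \<open>2 * d \<le> n + 1\<close>, and length \<open>d\<close> suits the repetition code if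
      \<open>n + 2 \<le> 2 * d\<close>.\<close>
    consider (large) "d \<le> k" | (block) "k < d" "2 * d \<le> n + 1" | (rep) "k < d" "n + 2 \<le> 2 * d"
      by linarith
    then show ?thesis
    proof cases
      case large
      obtain h :: "nat \<Rightarrow> 'a vec" where h: "greedy_columns r d n h" using greedy by blast
      obtain H where "completed_matrix q r d n h H" using completed[OF h] by blast
      then obtain n' k' and C :: "'a vec set" where C: "linear_code n' k' C" "d \<le> min_distance C"
        "all_one n' \<in> C" and bounds: "n + 2 \<le> n' + d" "n' \<le> n + 1" "k + 2 \<le> k' + d" "k' \<le> k + 1"
        using code[OF h] by blast
      \<comment> \<open>Interpolation needs a nonzero word with first coordinate 0, hence dimension
        at least 2; this is where \<open>d \<le> k\<close> enters.\<close>
      have "2 \<le> k'" "0 < n'" using bounds large assms(7) by simp_all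
      then show ?thesis
        using exists_code_with_min_distance[OF C(1) _ _ C(3) assms(6) C(2)] bounds by blast
    next
      case block
      then show ?thesis
        using two_block_code[OF assms(6), of "n + 1", where 'a = 'a] assms(4)
        by (intro exI[of _ "n + 1"] exI[of _ 2] exI) auto
    next
      case rep
      then show ?thesis
        using repetition_code[OF assms(6), where 'a = 'a] assms(7)
        by (intro exI[of _ d] exI[of _ 1] exI) auto
    qed
  qed
  show ?thesis
    unfolding r_def[symmetric]
    using exact less_l column greedy completed code by (intro conjI ballI allI impI) auto
qed

end
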